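(* In the noiseless model there is a randomized algorithm for PARTITION on $n$ elements with query complexity $O(n\log^8 n)$ and round complexity $3$ which, for all $c$, outputs a partition with zero $c$-weighted error with probability $1-O(\log n/n^2)$.
   Context: Setting. The input is a set of $n$ elements with an unknown total order, presented in uniformly random order (the elements are a priori indistinguishable). For $i\in\{1,\dots,n\}$ the $i$-th smallest element is denoted $i$. PARTITION (with cutoff the median, $k=n/2$): output a partition of the elements into a set $A$ (accepted, meant to be the elements above the median) and a set $R$ (rejected, meant to be the elements below the median). For a constant $c\ge 0$, the $c$-weighted error of $A\sqcup R$ is $\sum_{i>n/2} I(i\in R)\,|i-n/2|^c+\sum_{i<n/2} I(i\in A)\,|i-n/2|^c$, where $I$ is the indicator function (so zero error means no element above or below the median is misplaced). Algorithms access the order only through pairwise comparison queries. Query complexity is the total number of comparisons; round complexity is the number of adaptive rounds (within a round all queries are chosen before any answer of that round is seen). Noiseless model: every comparison returns the correct answer. Asymptotics are as $n\to\infty$. Probabilities are over the random input order and the algorithm's randomness. *)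

theory Defs
  imports
    "HOL-Probability.Probability"
    "HOL-Combinatorics.Permutations"
    "HOL-Library.Landau_Symbols"
begin

text \<open>
  The input is a permutation \<open>p\<close> of \<open>{1..n}\<close>: the item presented at position \<open>x\<close> is
  the \<open>p x\<close>-th smallest element. An algorithm only ever names positions and only learns about \<open>p\<close>
  through comparisons. A query is an unordered pair \<open>{x, y}\<close> of distinct positions.
\<close>

definition comparisons :: "nat \<Rightarrow> nat set set" where
  "comparisons n = {{x, y} | x y. x \<in> {1..n} \<and> y \<in> {1..n} \<and> x \<noteq> y}"

text \<open>
  The (correct) answers to a set of queries are recorded as the set of pairs \<open>(x, y)\<close> such that
  \<open>x\<close> and \<open>y\<close> were compared and \<open>x\<close> turned out to be the smaller of the two. A history lists
  the answers of the rounds played so far.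
\<close>

definition answers :: "(nat \<Rightarrow> nat) \<Rightarrow> nat set set \<Rightarrow> (nat \<times> nat) set" where
  "answers p Q = {(x, y). {x, y} \<in> Q \<and> p x < p y}"

type_synonym history = "(nat \<times> nat) set list"

text \<open>
  A deterministic strategy fixes the number of rounds, the set of queries asked in the next round as
  a function of the answers of all earlier rounds, and the final output \<open>(A, R)\<close> of accepted and
  rejected positions. A randomized algorithm is a distribution over deterministic strategies.
\<close>

record strategy =
  rounds :: nat
  ask :: "history \<Rightarrow> nat set set"
  decide :: "history \<Rightarrow> nat set \<times> nat set"

type_synonym randomized_algorithm = "strategy pmf"

text \<open>In particular \<open>ask a h\<close> is always finite, so that \<open>card\<close> below does count the queries.\<close>

definition valid_strategy :: "nat \<Rightarrow> strategy \<Rightarrow> bool" where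
  "valid_strategy n a \<longleftrightarrow>
     (\<forall>h. ask a h \<subseteq> comparisons n \<and>
          fst (decide a h) \<union> snd (decide a h) = {1..n} \<and>
          fst (decide a h) \<inter> snd (decide a h) = {})"

primrec play :: "strategy \<Rightarrow> (nat \<Rightarrow> nat) \<Rightarrow> nat \<Rightarrow> history" where
  "play a p 0 = []"
| "play a p (Suc r) = play a p r @ [answers p (ask a (play a p r))]"

definition num_queries :: "strategy \<Rightarrow> (nat \<Rightarrow> nat) \<Rightarrow> nat" where
  "num_queries a p = (\<Sum>r<rounds a. card (ask a (play a p r)))"

text \<open>The output partition, translated from positions to the elements (ranks) \<open>1, \<dots>, n\<close>.\<close>

definition output_partition :: "strategy \<Rightarrow> (nat \<Rightarrow> nat) \<Rightarrow> nat set \<times> nat set" where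
  "output_partition a p =
     (let (A, R) = decide a (play a p (rounds a)) in (p ` A, p ` R))"

definition random_input :: "nat \<Rightarrow> (nat \<Rightarrow> nat) pmf" where
  "random_input n = pmf_of_set {p. p permutes {1..n}}"

definition outcome :: "nat \<Rightarrow> randomized_algorithm \<Rightarrow> (nat set \<times> nat set) pmf" where
  "outcome n M = map_pmf (\<lambda>(a, p). output_partition a p) (pair_pmf M (random_input n))"

definition weighted_error :: "real \<Rightarrow> nat \<Rightarrow> nat set \<times> nat set \<Rightarrow> real" where
  "weighted_error c n = (\<lambda>(A, R).
     (\<Sum>i | i \<in> {1..n} \<and> real i > real n / 2. indicator R i * \<bar>real i - real n / 2\<bar> powr c) +
     (\<Sum>i | i \<in> {1..n} \<and> real i < real n / 2. indicator A i * \<bar>real i - real n / 2\<bar> powr c))"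

definition valid_algorithm :: "nat \<Rightarrow> randomized_algorithm \<Rightarrow> bool" where
  "valid_algorithm n M \<longleftrightarrow> (\<forall>a\<in>set_pmf M. valid_strategy n a)"

definition has_round_complexity :: "randomized_algorithm \<Rightarrow> nat \<Rightarrow> bool" where
  "has_round_complexity M r \<longleftrightarrow> (\<forall>a\<in>set_pmf M. rounds a = r)"

text \<open>Query complexity is worst case, over both the input order and the random choices.\<close>

definition query_bound :: "nat \<Rightarrow> randomized_algorithm \<Rightarrow> real \<Rightarrow> bool" where
  "query_bound n M q \<longleftrightarrow>
     (\<forall>a\<in>set_pmf M. \<forall>p. p permutes {1..n} \<longrightarrow> real (num_queries a p) \<le> q)"

end

theory Submission
  imports Defs "HOL-Real_Asymp.Real_Asymp"
begin

text \<open>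
  The algorithm draws uniform positions \<open>X 0, X 1, \<dots>\<close>, and its first round compares the first
  \<open>2 ^ (j + 1)\<close> of them with the first \<open>n / 2 ^ j\<close> of them, for every \<open>j\<close> with \<open>4 ^ (j + 1) \<le> n\<close>; each
  level costs only \<open>2 n\<close> comparisons. Given a target rank \<open>t\<close>, it then zooms in: if \<open>a\<close> is a pivot
  at distance about \<open>n / 2 ^ j\<close> below \<open>t\<close>, the rank of any \<open>h\<close> among the first \<open>2 ^ (j + 1)\<close>
  samples is estimated by the rank of \<open>a\<close> plus the rescaled number of the \<open>n / 2 ^ j\<close> samples
  between \<open>a\<close> and \<open>h\<close>. About \<open>n / 4 ^ j\<close> samples lie there, so rescaling their fluctuation by
  \<open>2 ^ j\<close> gives an error of \<open>sqrt n\<close> up to logarithms at every level, although the gap to \<open>t\<close>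
  halves. This ends with a pivot whose rank is within \<open>sqrt n\<close> times a power of the logarithm of \<open>t\<close>.

  Taking \<open>t\<close> slightly below and slightly above the median gives two pivots that bracket the median.
  The second round compares everything with both pivots, and the third round compares all pairs of
  elements between the pivots.
\<close>

subsection \<open>Deviations of sample counts\<close>


text \<open>For negative \<open>s = - t\<close> the bound comes from
  \<open>(1 + t) * (1 - t + t\<^sup>2) = 1 + t ^ 3 \<ge> 1\<close> and
  \<open>1 + t \<le> exp t\<close>.\<close>

lemma exp_le_quadratic:
  fixes s :: real
  assumes "\<bar>s\<bar> \<le> 1"
  shows "exp s \<le> 1 + s + s\<^sup>2"
proof (cases "s \<ge> 0")
  case True
  then show ?thesis using assms exp_bound[of s] by simp
next
  case False
  define t where "t = - s"
  have t: "0 < t" "t \<le> 1" using False assms by (auto simp: t_def)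
  have "1 \<le> (1 + t) * (1 - t + t\<^sup>2)"
    using t by (simp add: algebra_simps power2_eq_square)
  also have "\<dots> \<le> exp t * (1 - t + t\<^sup>2)"
    using t by (intro mult_right_mono exp_ge_add_one_self) auto
  finally have "exp (- t) \<le> 1 - t + t\<^sup>2"
    by (simp add: exp_minus field_simps)
  then show ?thesis by (simp add: t_def)
qed

text \<open>By independence the expectation is a product of factors
  \<open>1 + \<beta> * (exp s - 1)\<close>, where \<open>\<beta>\<close> is the probability of
  \<open>B\<close>, and each factor is at most \<open>exp (\<beta> * (s + s\<^sup>2))\<close>.
  Negative \<open>s\<close> is allowed so that the lower tail is covered too.\<close>

lemma expectation_exp_count_Pi_pmf:
  fixes q :: "'b pmf" and s :: real
  assumes "finite I" "K \<subseteq> I" "\<bar>s\<bar> \<le> 1"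
  shows "measure_pmf.expectation (Pi_pmf I d (\<lambda>_. q)) (\<lambda>X. exp (s * real (card {k\<in>K. X k \<in> B})))
           \<le> exp (real (card K) * measure_pmf.prob q B * (s + s\<^sup>2))"
proof -
  define \<beta> where "\<beta> = measure_pmf.prob q B"
  define f where "f = (\<lambda>k v. if k \<in> K \<and> v \<in> B then exp s else (1::real))"
  have prod: "exp (s * real (card {k\<in>K. X k \<in> B})) = (\<Prod>k\<in>I. f k (X k))" for X
  proof -
    have "(\<Prod>k\<in>I. f k (X k)) = (\<Prod>k\<in>{k\<in>I. k \<in> K \<and> X k \<in> B}. exp s)"
      unfolding f_def using \<open>finite I\<close> by (rule prod.inter_filter[symmetric])
    also have "{k\<in>I. k \<in> K \<and> X k \<in> B} = {k\<in>K. X k \<in> B}" using assms by auto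
    finally show ?thesis by (simp add: exp_of_nat2_mult)
  qed
  have int: "integrable (measure_pmf q) (f k)" for k
    by (rule measure_pmf.integrable_const_bound[where B = "max 1 (exp s)"]) (auto simp: f_def)
  have one: "measure_pmf.expectation q (f k) = (if k \<in> K then 1 + \<beta> * (exp s - 1) else 1)" for k
  proof (cases "k \<in> K")
    case True
    have "f k = (\<lambda>v. 1 + (exp s - 1) * indicator B v)"
      using True by (auto simp: f_def fun_eq_iff indicator_def)
    moreover have "integrable (measure_pmf q) (indicator B :: _ \<Rightarrow> real)"
      by (rule measure_pmf.integrable_const_bound[where B = 1]) auto
    ultimately show ?thesis using True
      by (simp add: \<beta>_def measure_pmf.prob_space)
  qed (simp add: f_def measure_pmf.prob_space)
  have \<beta>: "0 \<le> \<beta>" "\<beta> \<le> 1" by (simp_all add: \<beta>_def)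
  have "measure_pmf.expectation (Pi_pmf I d (\<lambda>_. q)) (\<lambda>X. exp (s * real (card {k\<in>K. X k \<in> B})))
      = (\<Prod>k\<in>I. measure_pmf.expectation q (f k))"
    unfolding prod using assms int by (intro expectation_prod_Pi_pmf) (auto simp: f_def)
  also have "\<dots> = (\<Prod>k\<in>{k\<in>I. k \<in> K}. 1 + \<beta> * (exp s - 1))"
    unfolding one using \<open>finite I\<close> by (rule prod.inter_filter[symmetric])
  also have "{k\<in>I. k \<in> K} = K" using assms by auto
  also have "(\<Prod>k\<in>K. 1 + \<beta> * (exp s - 1)) = (1 + \<beta> * (exp s - 1)) ^ card K" by simp
  also have "\<dots> \<le> exp (\<beta> * (s + s\<^sup>2)) ^ card K"
  proof (rule power_mono)
    have "\<beta> * (exp s - 1) \<le> \<beta> * (s + s\<^sup>2)"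
      using exp_le_quadratic[OF assms(3)] \<beta> by (intro mult_left_mono) auto
    also have "1 + \<beta> * (s + s\<^sup>2) \<le> exp (\<beta> * (s + s\<^sup>2))" by (rule exp_ge_add_one_self)
    finally show "1 + \<beta> * (exp s - 1) \<le> exp (\<beta> * (s + s\<^sup>2))" by simp
    have "0 \<le> (1 - \<beta>) + \<beta> * exp s" using \<beta> by simp
    then show "0 \<le> 1 + \<beta> * (exp s - 1)" by (simp add: algebra_simps)
  qed
  also have "\<dots> = exp (real (card K) * \<beta> * (s + s\<^sup>2))"
    by (simp add: exp_of_nat_mult[symmetric] mult_ac)
  finally show ?thesis by (simp add: \<beta>_def)
qed

text \<open>Chernoff's bound in Bernstein form: the square root governs large means, the additive
  \<open>\<kappa>\<close> small ones.\<close>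

lemma count_Pi_pmf_deviation:
  fixes q :: "'b pmf" and B :: "'b set" and \<kappa> :: real
  assumes "finite I" "K \<subseteq> I" "\<kappa> > 0"
  defines "\<mu> \<equiv> real (card K) * measure_pmf.prob q B"
  shows "measure_pmf.prob (Pi_pmf I d (\<lambda>_. q))
           {X. \<bar>real (card {k\<in>K. X k \<in> B}) - \<mu>\<bar> > sqrt (\<kappa> * \<mu>) + \<kappa>} \<le> 2 * exp (- \<kappa> / 4)"
proof -
  define P where "P = Pi_pmf I d (\<lambda>_. q)"
  define N where "N = (\<lambda>X. real (card {k\<in>K. X k \<in> B}))"
  define t where "t = sqrt (\<kappa> * \<mu>) + \<kappa>"
  have \<mu>: "\<mu> \<ge> 0" by (simp add: \<mu>_def)
  have finK: "finite K" using assms finite_subset by blast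
  \<comment> \<open>Choice of the exponent \<open>s\<close> in Chernoff's bound.\<close>
  obtain s where s: "0 < s" "s \<le> 1" "\<mu> * s\<^sup>2 - s * t \<le> - \<kappa> / 4"
  proof (cases "\<mu> \<le> \<kappa>")
    case True
    have "\<mu> = sqrt (\<mu> * \<mu>)" using \<mu> by simp
    also have "\<dots> \<le> sqrt (\<kappa> * \<mu>)" using True \<mu> by (intro real_sqrt_le_mono mult_right_mono)
    finally show ?thesis using \<open>\<kappa> > 0\<close> by (intro that[of 1]) (auto simp: t_def)
  next
    case False
    \<comment> \<open>The exponent \<open>r / 2\<close> minimises
      \<open>\<mu> * s\<^sup>2 - s * sqrt (\<kappa> * \<mu>)\<close>. It makes the first term
      \<open>\<kappa> / 4\<close> and \<open>s * t\<close> at least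
      \<open>\<kappa> / 2\<close>.\<close>
    define r where "r = sqrt (\<kappa> / \<mu>)"
    have r: "0 < r" "r \<le> 1" using False \<open>\<kappa> > 0\<close> by (auto simp: r_def)
    have r2: "\<mu> * r\<^sup>2 = \<kappa>" using False \<open>\<kappa> > 0\<close> by (simp add: r_def)
    have "r * sqrt (\<kappa> * \<mu>) = sqrt (\<kappa> * \<kappa>)"
      unfolding r_def real_sqrt_mult[symmetric] using False \<open>\<kappa> > 0\<close> by (simp add: field_simps)
    then have "r * t \<ge> \<kappa>" using r \<open>\<kappa> > 0\<close> by (simp add: t_def distrib_left)
    then show ?thesis using r r2 \<open>\<kappa> > 0\<close>
      by (intro that[of "r / 2"]) (auto simp: power_divide)
  qed
  \<comment> \<open>The sign \<open>\<sigma>\<close> treats both tails at once, by Markov's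
    inequality for \<open>exp ((s * \<sigma>) * N X)\<close>.\<close>
  have tail: "measure_pmf.prob P {X. \<sigma> * (N X - \<mu>) \<ge> t} \<le> exp (- \<kappa> / 4)" if \<sigma>: "\<bar>\<sigma>\<bar> = 1" for \<sigma>
  proof -
    have N_le: "N X \<le> card K" for X unfolding N_def using finK by (auto intro!: card_mono)
    have int: "integrable (measure_pmf P) (\<lambda>X. exp ((s * \<sigma>) * N X))"
    proof (rule measure_pmf.integrable_const_bound[where B = "exp (real (card K))"])
      have "(s * \<sigma>) * N X \<le> card K" for X
      proof -
        have "s * \<sigma> \<le> 1" using \<sigma> s by (cases "\<sigma> \<ge> 0") (auto simp: abs_if)
        then have "(s * \<sigma>) * N X \<le> 1 * N X" by (intro mult_right_mono) (auto simp: N_def)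
        then show ?thesis using N_le[of X] by simp
      qed
      then show "AE X in measure_pmf P. norm (exp ((s * \<sigma>) * N X)) \<le> exp (real (card K))" by simp
    qed simp
    have "\<sigma> * (N X - \<mu>) \<ge> t \<longleftrightarrow> s * (\<sigma> * (N X - \<mu>)) \<ge> s * t" for X
      using s by simp
    then have "\<sigma> * (N X - \<mu>) \<ge> t \<longleftrightarrow> (s * \<sigma>) * N X \<ge> s * t + s * \<sigma> * \<mu>" for X
      by (simp only:) (simp add: algebra_simps)
    then have "measure_pmf.prob P {X. \<sigma> * (N X - \<mu>) \<ge> t}
        = measure_pmf.prob P {X \<in> space (measure_pmf P). exp ((s * \<sigma>) * N X) \<ge> exp (s * t + s * \<sigma> * \<mu>)}"
      by simp
    also have "\<dots> \<le> measure_pmf.expectation P (\<lambda>X. exp ((s * \<sigma>) * N X)) / exp (s * t + s * \<sigma> * \<mu>)"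
      using int by (intro integral_Markov_inequality_measure) auto
    also have "\<dots> \<le> exp (\<mu> * (s * \<sigma> + (s * \<sigma>)\<^sup>2)) / exp (s * t + s * \<sigma> * \<mu>)"
      unfolding P_def N_def \<mu>_def using assms(1,2) s \<sigma>
      by (intro divide_right_mono expectation_exp_count_Pi_pmf) (auto simp: abs_mult)
    also have "\<dots> = exp (\<mu> * s\<^sup>2 - s * t)"
    proof -
      have "\<sigma>\<^sup>2 = 1" using \<sigma> by (metis one_power2 power2_abs)
      then show ?thesis by (simp add: exp_diff[symmetric] algebra_simps power_mult_distrib)
    qed
    also have "\<dots> \<le> exp (- \<kappa> / 4)" using s by simp
    finally show ?thesis .
  qed
  have "measure_pmf.prob P {X. \<bar>N X - \<mu>\<bar> > t}
      \<le> measure_pmf.prob P ({X. 1 * (N X - \<mu>) \<ge> t} \<union> {X. (-1) * (N X - \<mu>) \<ge> t})"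
    by (intro measure_pmf.finite_measure_mono) auto
  also have "\<dots> \<le> measure_pmf.prob P {X. 1 * (N X - \<mu>) \<ge> t} + measure_pmf.prob P {X. (-1) * (N X - \<mu>) \<ge> t}"
    by (intro measure_Un_le) auto
  also have "\<dots> \<le> exp (- \<kappa> / 4) + exp (- \<kappa> / 4)"
    by (intro add_mono tail) auto
  finally show ?thesis by (simp add: P_def N_def t_def)
qed


section \<open>Simultaneous concentration over sample prefixes and rank intervals\<close>

text \<open>\<open>Y k\<close> stands for the rank of the \<open>k\<close>-th sample. All prefixes
  and intervals are demanded at once because the intervals used later end at pivots that depend on
  the sample itself.\<close>

definition concentrated :: "real \<Rightarrow> nat \<Rightarrow> (nat \<Rightarrow> nat) \<Rightarrow> bool" where
  "concentrated \<kappa> n Y \<longleftrightarrow> (\<forall>m\<le>n. \<forall>v\<le>n. \<forall>u\<le>v.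
     \<bar>real (card {k\<in>{..<m}. Y k \<in> {u<..v}}) - real m * real (v - u) / real n\<bar>
       \<le> sqrt (\<kappa> * (real m * real (v - u) / real n)) + \<kappa>)"

text \<open>Drawing with replacement keeps the coordinates independent, as Chernoff's bound
  requires.\<close>

definition random_sample :: "nat \<Rightarrow> (nat \<Rightarrow> nat) pmf" where
  "random_sample n = Pi_pmf {..<n} 0 (\<lambda>_. pmf_of_set {1..n})"

lemma random_sample_range:
  assumes "X \<in> set_pmf (random_sample n)" "k < n"
  shows "X k \<in> {1..n}"
proof -
  have "X \<in> PiE_dflt {..<n} 0 (set_pmf \<circ> (\<lambda>_. pmf_of_set {1..n}))"
    using assms unfolding random_sample_def by (simp add: set_Pi_pmf)
  then show ?thesis using assms(2) by (auto simp: PiE_dflt_def)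
qed

lemma prob_rank_in_interval:
  assumes "p permutes {1..n}" "v \<le> n" "0 < n"
  shows "measure_pmf.prob (pmf_of_set {1..n}) {x. p x \<in> {u<..v}} = real (v - u) / real n"
proof -
  have "p ` ({1..n} \<inter> {x. p x \<in> {u<..v}}) = {u<..v}"
  proof (intro equalityI subsetI)
    fix y assume y: "y \<in> {u<..v}"
    then have "y \<in> p ` {1..n}" using assms by (simp add: permutes_image)
    then show "y \<in> p ` ({1..n} \<inter> {x. p x \<in> {u<..v}})" using y by auto
  qed auto
  then have "card ({1..n} \<inter> {x. p x \<in> {u<..v}}) = v - u"
    using card_image[of p "{1..n} \<inter> {x. p x \<in> {u<..v}}"] permutes_inj_on[OF assms(1)]
    by (metis card_greaterThanAtMost)
  then show ?thesis using assms by (simp add: measure_pmf_of_set)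
qed

text \<open>Union bound over \<open>(n + 1) ^ 3 \<le> (2 * n) ^ 3\<close> triples
  \<open>(m, u, v)\<close>, each failing with probability at most
  \<open>2 * exp (- \<kappa> / 4)\<close>. The input order \<open>p\<close> is fixed here; only the
  sample is random.\<close>

lemma prob_not_concentrated:
  assumes p: "p permutes {1..n}" and "0 < n" "0 < \<kappa>"
  shows "measure_pmf.prob (random_sample n) {X. \<not> concentrated \<kappa> n (\<lambda>k. p (X k))}
           \<le> 16 * real n ^ 3 * exp (- \<kappa> / 4)"
proof -
  define bad where "bad = (\<lambda>(m, u, v). {X :: nat \<Rightarrow> nat.
    \<bar>real (card {k\<in>{..<m}. p (X k) \<in> {u<..v}}) - real m * real (v - u) / real n\<bar>
       > sqrt (\<kappa> * (real m * real (v - u) / real n)) + \<kappa>})"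
  define T where "T = {..n} \<times> {..n} \<times> {..n}"
  have bad: "measure_pmf.prob (random_sample n) (bad \<tau>) \<le> 2 * exp (- \<kappa> / 4)" if \<tau>: "\<tau> \<in> T" for \<tau>
  proof -
    obtain m u v where muv: "\<tau> = (m, u, v)" "m \<le> n" "v \<le> n" using \<tau> by (cases \<tau>) (auto simp: T_def)
    show ?thesis
      using count_Pi_pmf_deviation[of "{..<n}" "{..<m}" \<kappa> 0 "pmf_of_set {1..n}" "{x. p x \<in> {u<..v}}"]
        prob_rank_in_interval[OF p, of v u] muv assms
      by (simp add: bad_def random_sample_def)
  qed
  have "{X. \<not> concentrated \<kappa> n (\<lambda>k. p (X k))} \<subseteq> (\<Union>\<tau>\<in>T. bad \<tau>)"
  proof
    fix X assume "X \<in> {X. \<not> concentrated \<kappa> n (\<lambda>k. p (X k))}"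
    then obtain m u v where "m \<le> n" "v \<le> n" "u \<le> v" "X \<in> bad (m, u, v)"
      by (auto simp: concentrated_def bad_def not_le)
    moreover from this have "(m, u, v) \<in> T" by (simp add: T_def)
    ultimately show "X \<in> (\<Union>\<tau>\<in>T. bad \<tau>)" by blast
  qed
  then have "measure_pmf.prob (random_sample n) {X. \<not> concentrated \<kappa> n (\<lambda>k. p (X k))}
      \<le> measure_pmf.prob (random_sample n) (\<Union>\<tau>\<in>T. bad \<tau>)"
    by (intro measure_pmf.finite_measure_mono) auto
  also have "\<dots> \<le> (\<Sum>\<tau>\<in>T. measure_pmf.prob (random_sample n) (bad \<tau>))"
    by (intro measure_UNION_le) (auto simp: T_def)
  also have "\<dots> \<le> (\<Sum>\<tau>\<in>T. 2 * exp (- \<kappa> / 4))"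
    by (intro sum_mono bad)
  also have "\<dots> = 2 * real (n + 1) ^ 3 * exp (- \<kappa> / 4)"
    by (simp add: T_def card_cartesian_product power3_eq_cube algebra_simps)
  also have "\<dots> \<le> 2 * (2 * real n) ^ 3 * exp (- \<kappa> / 4)"
    using \<open>0 < n\<close> by (intro mult_right_mono mult_left_mono power_mono) auto
  finally show ?thesis by (simp add: power_mult_distrib)
qed

text \<open>For an expected count \<open>\<mu> \<ge> 4 * \<kappa>\<close> the deviation is at most
  \<open>\<mu> / 2 + \<mu> / 4\<close>, so the count is positive.\<close>

lemma concentrated_hit:
  assumes "concentrated \<kappa> n Y" "m \<le> n" "u \<le> v" "v \<le> n" "0 < \<kappa>"
    and "4 * \<kappa> \<le> real m * real (v - u) / real n"
  shows "\<exists>k<m. u < Y k \<and> Y k \<le> v"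
proof -
  define \<mu> where "\<mu> = real m * real (v - u) / real n"
  have "\<bar>real (card {k\<in>{..<m}. Y k \<in> {u<..v}}) - \<mu>\<bar> \<le> sqrt (\<kappa> * \<mu>) + \<kappa>"
    using assms by (simp add: concentrated_def \<mu>_def)
  moreover have "sqrt (\<kappa> * \<mu>) \<le> \<mu> / 2"
  proof (rule real_le_lsqrt)
    have "4 * \<kappa> \<le> \<mu>" using assms(6) unfolding \<mu>_def .
    then have "\<kappa> * \<mu> \<le> (\<mu> / 4) * \<mu>" using assms(5) by (intro mult_right_mono) linarith+
    then show "\<kappa> * \<mu> \<le> (\<mu> / 2)\<^sup>2" by (simp add: power2_eq_square)
  qed (use assms in \<open>auto simp: \<mu>_def\<close>)
  ultimately have "real (card {k\<in>{..<m}. Y k \<in> {u<..v}}) > 0"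
    using assms(5,6) unfolding \<mu>_def[symmetric] by linarith
  then have "{k\<in>{..<m}. Y k \<in> {u<..v}} \<noteq> {}" by (metis card.empty of_nat_0 less_irrefl)
  then show ?thesis by auto
qed

text \<open>The error of one level. The fluctuation \<open>sqrt (\<kappa> * \<mu>)\<close> rescaled
  by \<open>c\<close> is the square root of \<open>\<kappa> * c * (c * \<mu>)\<close>; here
  \<open>c\<close> is at most \<open>2 * 2 ^ j\<close> and \<open>c * \<mu>\<close> is of order
  \<open>d\<close>, so the factor \<open>2 ^ j\<close> cancels against the bound on
  \<open>d\<close>. In \<open>small\<close>, either the estimated width or the true one may be the
  one known to be at most \<open>d\<close>.\<close>

lemma scaled_count_error:
  fixes d :: real
  assumes conc: "concentrated \<kappa> n Y" and \<kappa>: "20 \<le> \<kappa>" and j: "4 ^ Suc j \<le> n"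
    and uv: "u \<le> v" "v \<le> n" and d: "d * 2 ^ j \<le> \<kappa> ^ 3 * real n"
  defines "m \<equiv> n div 2 ^ j"
  defines "c \<equiv> real n / real m" and "N \<equiv> real (card {k\<in>{..<m}. Y k \<in> {u<..v}})"
  assumes small: "c * N \<le> d \<or> real (v - u) \<le> d"
  shows "\<bar>c * N - real (v - u)\<bar> \<le> 4 * \<kappa>\<^sup>2 * sqrt (real n)"
proof -
  have two_le_four: "(2::nat) ^ j \<le> 4 ^ Suc j"
    by (rule order_trans[OF power_mono[of 2 4 j]]) auto
  then have "2 ^ j \<le> n" using j by simp
  then have m1: "1 \<le> m" by (simp add: m_def Suc_le_eq div_greater_zero_iff)
  have n: "0 < n" using \<open>2 ^ j \<le> n\<close> by (cases n) auto
  have "n < 2 ^ j * (m + 1)"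
    using dividend_less_times_div[of "2 ^ j" n] by (simp add: m_def)
  also have "\<dots> \<le> 2 ^ j * (2 * m)" using m1 by (intro mult_left_mono) auto
  finally have "real n \<le> real (2 ^ j * (2 * m))" by linarith
  then have c: "c \<le> 2 * 2 ^ j" "0 < c" using m1 n by (auto simp: c_def field_simps)
  have c2: "c\<^sup>2 \<le> real n"
  proof -
    have "c\<^sup>2 \<le> (2 * 2 ^ j)\<^sup>2" using c by (intro power_mono) auto
    also have "\<dots> = real (4 ^ Suc j)" by (simp add: power_mult_distrib power_mult[symmetric] mult.commute[of j] power_mult)
    also have "\<dots> \<le> real n" using j by (simp only: of_nat_le_iff)
    finally show ?thesis .
  qed
  define w where "w = real (v - u)"
  define \<mu> where "\<mu> = real m * w / real n"
  have \<mu>: "0 \<le> \<mu>" "c * \<mu> = w" using m1 n by (auto simp: \<mu>_def w_def c_def)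
  have "m \<le> n" by (simp add: m_def)
  then have dev: "\<bar>N - \<mu>\<bar> \<le> sqrt (\<kappa> * \<mu>) + \<kappa>"
    using conc uv by (simp add: concentrated_def N_def \<mu>_def w_def)
  \<comment> \<open>By the arithmetic-geometric mean inequality the observed count bounds its own
    expectation, which turns a small estimate into a small true width.\<close>
  have "sqrt (\<kappa> * \<mu>) \<le> (\<kappa> + \<mu>) / 2" using \<mu> \<kappa> by (intro arith_geo_mean_sqrt) auto
  moreover have "\<mu> \<le> N + (sqrt (\<kappa> * \<mu>) + \<kappa>)" using dev by (simp only: abs_le_iff) auto
  ultimately have "\<mu> \<le> 2 * N + 3 * \<kappa>" by (simp only: field_simps)
  then have "c * \<mu> \<le> c * (2 * N + 3 * \<kappa>)" using c by (intro mult_left_mono) auto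
  then have c\<mu>: "c * \<mu> \<le> 2 * d + 3 * \<kappa> * c"
  proof -
    have "0 \<le> 3 * \<kappa> * c" "0 \<le> c * \<mu>" using c \<kappa> \<mu> by auto
    then show ?thesis using small \<open>c * \<mu> \<le> c * (2 * N + 3 * \<kappa>)\<close> \<mu>(2)
      by (auto simp: w_def algebra_simps)
  qed
  have d0: "0 \<le> d" using small c by (auto simp: N_def intro: order_trans[rotated])
  \<comment> \<open>Under the root, \<open>c * d\<close> and \<open>c\<^sup>2\<close> are bounded by
    multiples of \<open>n\<close>. The resulting factor 7 is raised to 9 to obtain a perfect
    square.\<close>
  have "c * sqrt (\<kappa> * \<mu>) = sqrt (c\<^sup>2 * (\<kappa> * \<mu>))" using c by (simp add: real_sqrt_mult)
  also have "c\<^sup>2 * (\<kappa> * \<mu>) = \<kappa> * c * (c * \<mu>)" by (simp add: power2_eq_square)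
  also have "\<dots> \<le> \<kappa> * c * (2 * d + 3 * \<kappa> * c)" using c\<mu> c \<kappa> by (intro mult_left_mono) auto
  also have "\<dots> = \<kappa> * (2 * (d * c) + 3 * \<kappa> * c\<^sup>2)" by (simp add: power2_eq_square algebra_simps)
  also have "\<dots> \<le> \<kappa> * (4 * (\<kappa> ^ 3 * real n) + 3 * \<kappa> ^ 3 * real n)"
  proof -
    have "d * c \<le> d * (2 * 2 ^ j)" using c d0 by (intro mult_left_mono) auto
    also have "\<dots> = 2 * (d * 2 ^ j)" by simp
    finally have "2 * (d * c) \<le> 4 * (\<kappa> ^ 3 * real n)" using d by linarith
    moreover have "3 * \<kappa> * c\<^sup>2 \<le> 3 * \<kappa> ^ 3 * real n"
      using c2 \<kappa> self_le_power[of \<kappa> 3] by (intro mult_mono) auto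
    moreover have "0 \<le> \<kappa>" using \<kappa> by simp
    ultimately show ?thesis by (intro mult_left_mono add_mono)
  qed
  also have "\<dots> = 7 * (\<kappa> ^ 4 * real n)" by (simp add: eval_nat_numeral)
  also have "\<dots> \<le> 9 * (\<kappa> ^ 4 * real n)" by simp
  also have "\<dots> = (3 * \<kappa>\<^sup>2 * sqrt (real n))\<^sup>2" by (simp add: power_mult_distrib)
  finally have "c * sqrt (\<kappa> * \<mu>) \<le> 3 * \<kappa>\<^sup>2 * sqrt (real n)" by (simp add: real_le_lsqrt)
  moreover have "c * \<kappa> \<le> \<kappa>\<^sup>2 * sqrt (real n)"
  proof -
    have "c \<le> sqrt (real n)" using c2 c by (simp add: real_le_rsqrt)
    moreover have "\<kappa> \<le> \<kappa>\<^sup>2" using \<kappa> self_le_power[of \<kappa> 2] by simp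
    ultimately have "c * \<kappa> \<le> sqrt (real n) * \<kappa>\<^sup>2" using c \<kappa> by (intro mult_mono) auto
    then show ?thesis by (simp add: mult.commute)
  qed
  moreover have "\<bar>c * N - w\<bar> = c * \<bar>N - \<mu>\<bar>"
    using c \<mu>(2) by (simp add: abs_mult_pos' flip: \<mu>(2) right_diff_distrib)
  moreover have "c * \<bar>N - \<mu>\<bar> \<le> c * (sqrt (\<kappa> * \<mu>) + \<kappa>)" using dev c by (intro mult_left_mono) auto
  ultimately show ?thesis by (simp add: w_def distrib_left)
qed

subsection \<open>Zooming in on a target rank\<close>


text \<open>
  Below, \<open>lt\<close> is the known part of the order. Position \<open>0\<close> is a sentinel below all elements:
  \<open>p permutes {1..n}\<close> forces \<open>p 0 = 0\<close>.
\<close>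

definition rank_estimate ::
    "(nat \<Rightarrow> nat \<Rightarrow> bool) \<Rightarrow> (nat \<Rightarrow> nat) \<Rightarrow> nat \<Rightarrow> nat \<Rightarrow> nat \<times> real \<Rightarrow> nat \<Rightarrow> real" where
  "rank_estimate lt X n j = (\<lambda>(a, e) h.
     e + real n / real (n div 2 ^ j) * real (card {k\<in>{..<n div 2 ^ j}. lt a (X k) \<and> \<not> lt h (X k)}))"

text \<open>Keeping \<open>a\<close> among the candidates provides a fallback when no sample
  improves on it. The condition \<open>\<not> lt h a\<close>, rather than \<open>lt a h\<close>,
  admits \<open>a\<close> itself.\<close>

definition refine ::
    "(nat \<Rightarrow> nat \<Rightarrow> bool) \<Rightarrow> (nat \<Rightarrow> nat) \<Rightarrow> nat \<Rightarrow> real \<Rightarrow> nat \<Rightarrow> nat \<times> real \<Rightarrow> nat \<times> real" where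
  "refine lt X n t j = (\<lambda>(a, e).
     let est = rank_estimate lt X n j (a, e);
         h = arg_max est (\<lambda>h. h \<in> insert a (X ` {..<2 ^ Suc j}) \<and> \<not> lt h a \<and> est h \<le> t)
     in (h, est h))"

text \<open>The start is the sentinel with its exact rank, so the initial estimate carries no
  error.\<close>

primrec pivot_chain ::
    "(nat \<Rightarrow> nat \<Rightarrow> bool) \<Rightarrow> (nat \<Rightarrow> nat) \<Rightarrow> nat \<Rightarrow> real \<Rightarrow> nat \<Rightarrow> nat \<times> real" where
  "pivot_chain lt X n t 0 = (0, 0)"
| "pivot_chain lt X n t (Suc j) = refine lt X n t j (pivot_chain lt X n t j)"

lemma arg_max_finite:
  fixes f :: "'a \<Rightarrow> 'b :: linorder"
  assumes "finite S" "x \<in> S"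
  shows "arg_max f (\<lambda>x. x \<in> S) \<in> S" "f x \<le> f (arg_max f (\<lambda>x. x \<in> S))"
proof -
  have "Max (f ` S) \<in> f ` S" using assms by (intro Max_in) auto
  then obtain y where "y \<in> S" "f y = Max (f ` S)" by auto
  then have "is_arg_max f (\<lambda>x. x \<in> S) y"
    using assms by (auto simp: is_arg_max_linorder)
  then have "is_arg_max f (\<lambda>x. x \<in> S) (arg_max f (\<lambda>x. x \<in> S))"
    unfolding arg_max_def by (rule someI)
  then show "arg_max f (\<lambda>x. x \<in> S) \<in> S" "f x \<le> f (arg_max f (\<lambda>x. x \<in> S))"
    using assms by (auto simp: is_arg_max_linorder)
qed

text \<open>Left arguments are candidates and right arguments are counted samples, matching the
  pairs queried in \<open>round1\<close>.\<close>

definition round_one_correct ::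
    "(nat \<Rightarrow> nat \<Rightarrow> bool) \<Rightarrow> (nat \<Rightarrow> nat) \<Rightarrow> nat \<Rightarrow> (nat \<Rightarrow> nat) \<Rightarrow> nat \<Rightarrow> bool" where
  "round_one_correct lt X n p J \<longleftrightarrow> (\<forall>j<J. \<forall>x\<in>insert 0 (X ` {..<2 ^ Suc j}).
     \<forall>y\<in>insert 0 (X ` {..<n div 2 ^ j}). lt x y \<longleftrightarrow> p x < p y)"

text \<open>
  The invariant for a pivot \<open>a\<close> with rank estimate \<open>e\<close>: the estimation error grows linearly in the
  level, while the gap to the target, measured by \<open>e\<close>, halves.
\<close>

definition tracks ::
    "real \<Rightarrow> nat \<Rightarrow> (nat \<Rightarrow> nat) \<Rightarrow> (nat \<Rightarrow> nat) \<Rightarrow> real \<Rightarrow> nat \<Rightarrow> nat \<times> real \<Rightarrow> bool" where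
  "tracks \<kappa> n p X t j = (\<lambda>(a, e). a \<in> insert 0 (X ` {..<2 ^ j}) \<and>
     \<bar>e - real (p a)\<bar> \<le> real j * (4 * \<kappa>\<^sup>2 * sqrt (real n)) \<and>
     e \<le> t \<and> (t - e) * 2 ^ j \<le> \<kappa> ^ 3 * real n)"

text \<open>Estimating relative to \<open>a\<close> adds one level error \<open>E\<close> to the
  error of \<open>e\<close>. For the gap, some sample falls into a window just below
  \<open>t\<close>; its estimate stays below \<open>t\<close>, so it is a candidate, and by
  maximality the chosen pivot has at least its estimate.\<close>

lemma refine_tracks:
  assumes conc: "concentrated \<kappa> n (\<lambda>k. p (X k))" and \<kappa>: "20 \<le> \<kappa>"
    and p: "p permutes {1..n}" and X: "\<And>k. k < n \<Longrightarrow> X k \<in> {1..n}"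
    and lt: "round_one_correct lt X n p J" and J: "j < J" "4 ^ J \<le> n" "20 * real J \<le> \<kappa>"
    and t: "t \<le> real n"
    and inv: "tracks \<kappa> n p X t j s"
  shows "tracks \<kappa> n p X t (Suc j) (refine lt X n t j s)"
proof -
  obtain a e where s: "s = (a, e)" by (cases s)
  define E where "E = 4 * \<kappa>\<^sup>2 * sqrt (real n)"
  define m where "m = n div 2 ^ j"
  define c where "c = real n / real m"
  define est where "est = rank_estimate lt X n j s"
  define C where "C = {h \<in> insert a (X ` {..<2 ^ Suc j}). \<not> lt h a \<and> est h \<le> t}"
  define h where "h = arg_max est (\<lambda>h. h \<in> C)"
  have refine: "refine lt X n t j s = (h, est h)"
    by (simp add: refine_def s h_def C_def est_def Let_def)
  have inv_a: "a \<in> insert 0 (X ` {..<2 ^ j})" and inv_err: "\<bar>e - real (p a)\<bar> \<le> real j * E"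
    and inv_le: "e \<le> t" and inv_gap: "(t - e) * 2 ^ j \<le> \<kappa> ^ 3 * real n"
    using inv by (auto simp: tracks_def s E_def)
  have four: "(4::nat) ^ Suc j \<le> n"
    using J power_increasing[of "Suc j" J "4::nat"] by simp
  have pow: "(2::nat) ^ Suc j * 2 ^ Suc j \<le> n" using four by (simp flip: power_mult_distrib)
  have pow': "(2::nat) ^ Suc j \<le> n" by (rule order_trans[OF _ pow]) simp
  \<comment> \<open>The candidates form a prefix of the counted samples, so \<open>lt\<close> is
    also correct between two candidates, as the filter \<open>\<not> lt h a\<close> demands.\<close>
  have sub: "2 ^ Suc j \<le> m"
  proof -
    have "2 ^ Suc j * 2 ^ j \<le> n" by (rule order_trans[OF _ pow]) simp
    then show ?thesis by (simp add: m_def less_eq_div_iff_mult_less_eq)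
  qed
  have "m \<le> n" by (simp add: m_def)
  have m0: "0 < m" by (rule less_le_trans[OF _ sub]) simp
  have p0: "p 0 = 0" using p by (simp add: permutes_not_in)
  have p_le: "p (X k) \<le> n" if "k < n" for k
    using X[OF that] permutes_in_image[OF p, of "X k"] by simp
  have a_mem: "a \<in> insert 0 (X ` {..<2 ^ Suc j})" using inv_a by auto
  have lt_iff: "lt x y \<longleftrightarrow> p x < p y"
    if "x \<in> insert 0 (X ` {..<2 ^ Suc j})" "y \<in> insert 0 (X ` {..<m})" for x y
    using lt J(1) that by (auto simp: round_one_correct_def m_def)
  have S_sub: "insert a (X ` {..<2 ^ Suc j}) \<subseteq> insert 0 (X ` {..<2 ^ Suc j})"
    "insert 0 (X ` {..<2 ^ Suc j}) \<subseteq> insert 0 (X ` {..<m})"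
    using a_mem sub by auto
  have est: "est x = e + c * real (card {k\<in>{..<m}. p (X k) \<in> {p a<..p x}})"
    if "x \<in> insert 0 (X ` {..<2 ^ Suc j})" for x
  proof -
    have "{k\<in>{..<m}. lt a (X k) \<and> \<not> lt x (X k)} = {k\<in>{..<m}. p (X k) \<in> {p a<..p x}}"
      using lt_iff[OF a_mem] lt_iff[OF that] by (auto simp: not_less)
    then show ?thesis by (simp add: est_def rank_estimate_def s m_def c_def)
  qed
  \<comment> \<open>The first alternative serves the chosen pivot, whose estimate is known; the
    second serves the sample in the window, whose rank is known.\<close>
  have err: "\<bar>est x - real (p x)\<bar> \<le> real (Suc j) * E"
    if x: "x \<in> insert 0 (X ` {..<2 ^ Suc j})" "p a \<le> p x"
      and small: "est x \<le> t \<or> real (p x - p a) \<le> t - e" for x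
  proof -
    have "p x \<le> n" using x p0 p_le pow' by auto
    then have "\<bar>c * real (card {k\<in>{..<m}. p (X k) \<in> {p a<..p x}}) - real (p x - p a)\<bar> \<le> E"
      unfolding E_def c_def m_def
      using small est[OF x(1)] x(2) inv_gap
      by (intro scaled_count_error[OF conc \<kappa> four, where d = "t - e"]) (auto simp: c_def m_def)
    then have "\<bar>est x - e - (real (p x) - real (p a))\<bar> \<le> E"
      using est[OF x(1)] x(2) by (simp add: of_nat_diff)
    then show ?thesis using inv_err by (simp add: distrib_right)
  qed
  have est_a: "est a = e" using est[OF a_mem] by simp
  have finC: "finite C" by (simp add: C_def)
  have a_C: "a \<in> C" using inv_le est_a lt_iff[of a a] a_mem S_sub by (auto simp: C_def)
  note h = arg_max_finite[OF finC a_C, of est, folded h_def]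
  have h_max: "est x \<le> est h" if "x \<in> C" for x
    using arg_max_finite(2)[OF finC that, of est] by (simp add: h_def)
  have h_mem: "h \<in> insert 0 (X ` {..<2 ^ Suc j})" and h_le: "est h \<le> t"
    using h(1) S_sub by (auto simp: C_def)
  have h_ge: "p a \<le> p h"
    using h(1) lt_iff[OF h_mem, of a] a_mem S_sub by (auto simp: C_def not_less)
  have h_err: "\<bar>est h - real (p h)\<bar> \<le> real (Suc j) * E"
    by (rule err[OF h_mem h_ge]) (use h_le in simp)
  have E0: "0 \<le> E" by (simp add: E_def)
  \<comment> \<open>A window of width \<open>w\<close> expects \<open>5 * \<kappa>\<close> of the
    candidates; the excess over \<open>4 * \<kappa>\<close> pays for rounding its ends. Below,
    \<open>lo\<close> is placed so that an overestimate by \<open>real (Suc j) * E\<close> at the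
    upper end still does not exceed \<open>t\<close>.\<close>
  define w where "w = 5 * \<kappa> * real n / 2 ^ Suc j"
  have w0: "0 \<le> w" using \<kappa> by (simp add: w_def)
  define lo where "lo = t - real (Suc j) * E - w"
  have "lo - real (Suc j) * E \<le> est h"
    \<comment> \<open>Either \<open>a\<close> itself is a good candidate, or some sample has its rank in \<open>{lo<..lo + w}\<close>.\<close>
  proof (cases "lo \<le> real (p a)")
    case True
    then show ?thesis using h_max[OF a_C] est_a inv_err E0 by (simp add: distrib_right)
  next
    case False
    \<comment> \<open>Ranks above \<open>u\<close> exceed \<open>lo\<close>, so rounding both ends
      down keeps the window within bounds and costs at most 1 in width.\<close>
    define u v where "u = nat \<lfloor>lo\<rfloor>" and "v = nat \<lfloor>lo + w\<rfloor>"
    have lo0: "0 \<le> lo" using False by linarith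
    have u: "real u \<le> lo" "lo < real u + 1" using lo0 by (auto simp: u_def)
    have v: "real v \<le> lo + w" "lo + w < real v + 1" using lo0 w0 by (auto simp: v_def)
    have "u \<le> v" unfolding u_def v_def using w0 by (intro nat_mono floor_mono) simp
    have "lo + w \<le> t" using E0 by (simp add: lo_def)
    then have "v \<le> n" using v t by linarith
    have "4 * \<kappa> \<le> real (2 ^ Suc j) * real (v - u) / real n"
    proof -
      have "w - 1 \<le> real (v - u)" using u v \<open>u \<le> v\<close> by (simp add: of_nat_diff)
      then have "real (2 ^ Suc j) * (w - 1) \<le> real (2 ^ Suc j) * real (v - u)"
        by (intro mult_left_mono) auto
      moreover have "real (2 ^ Suc j) * (w - 1) = 5 * \<kappa> * real n - real (2 ^ Suc j)"
        by (simp add: w_def right_diff_distrib)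
      moreover have "real (2 ^ Suc j) \<le> 20 * real n" using pow' by linarith
      moreover have "20 * real n \<le> \<kappa> * real n" using \<kappa> by (intro mult_right_mono) auto
      ultimately have "4 * \<kappa> * real n \<le> real (2 ^ Suc j) * real (v - u)"
        by linarith
      moreover have "0 < real n" using m0 \<open>m \<le> n\<close> by simp
      ultimately show ?thesis by (simp add: field_simps)
    qed
    moreover have "0 < \<kappa>" using \<kappa> by simp
    ultimately obtain i where i: "i < 2 ^ Suc j" "u < p (X i)" "p (X i) \<le> v"
      using concentrated_hit[OF conc pow' \<open>u \<le> v\<close> \<open>v \<le> n\<close>] by blast
    define x where "x = X i"
    have x_mem: "x \<in> X ` {..<2 ^ Suc j}" using i by (auto simp: x_def)
    then have x_mem': "x \<in> insert 0 (X ` {..<2 ^ Suc j})" by simp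
    have "real u + 1 \<le> real (p x)" using i by (simp add: x_def)
    then have x_lo: "lo < real (p x)" using u by linarith
    have x_hi: "real (p x) \<le> lo + w" using i v by (simp add: x_def)
    have x_ge: "p a \<le> p x" using x_lo False by linarith
    have "real (p x - p a) \<le> t - e"
      using x_hi x_ge inv_err E0 by (simp add: lo_def of_nat_diff distrib_right)
    then have x_err: "\<bar>est x - real (p x)\<bar> \<le> real (Suc j) * E"
      by (intro err[OF x_mem' x_ge]) simp
    then have "est x \<le> t" using x_hi by (simp add: lo_def)
    moreover have "\<not> lt x a" using lt_iff[OF x_mem', of a] a_mem S_sub x_ge by auto
    ultimately have "x \<in> C" using x_mem by (simp add: C_def)
    from h_max[OF this] x_err x_lo show ?thesis by linarith
  qed
  then have gap: "t - est h \<le> 2 * real (Suc j) * E + w" by (simp add: lo_def algebra_simps)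
  have "(t - est h) * 2 ^ Suc j \<le> (2 * real (Suc j) * E + w) * 2 ^ Suc j"
    using gap by (intro mult_right_mono) auto
  also have "\<dots> = 8 * real (Suc j) * \<kappa>\<^sup>2 * (sqrt (real n) * 2 ^ Suc j) + 5 * \<kappa> * real n"
    by (simp add: E_def w_def distrib_right)
  \<comment> \<open>The first term uses \<open>20 * J \<le> \<kappa>\<close> and
    \<open>2 ^ Suc j \<le> sqrt (real n)\<close>, the second
    \<open>\<kappa> * \<kappa> \<ge> 400\<close>. The total factor 2/5 + 1/80 is below 1, so the
    invariant reproduces itself.\<close>
  also have "\<dots> \<le> 8 * (\<kappa> / 20) * \<kappa>\<^sup>2 * real n + (\<kappa> ^ 3 / 80) * real n"
  proof -
    have "(2 ^ Suc j)\<^sup>2 \<le> real n"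
      using pow by (simp only: power2_eq_square flip: of_nat_le_iff[where 'a = real]) simp
    then have "2 ^ Suc j \<le> sqrt (real n)" by (rule real_le_rsqrt)
    then have "sqrt (real n) * 2 ^ Suc j \<le> sqrt (real n) * sqrt (real n)" by (intro mult_left_mono) auto
    then have "sqrt (real n) * 2 ^ Suc j \<le> real n" by simp
    moreover have "real (Suc j) \<le> \<kappa> / 20" using J by simp
    ultimately have "8 * real (Suc j) * \<kappa>\<^sup>2 * (sqrt (real n) * 2 ^ Suc j) \<le> 8 * (\<kappa> / 20) * \<kappa>\<^sup>2 * real n"
      using \<kappa> by (intro mult_mono) auto
    moreover have "5 * \<kappa> \<le> \<kappa> ^ 3 / 80"
    proof -
      have "20 * 20 \<le> \<kappa> * \<kappa>" using \<kappa> by (intro mult_mono) auto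
      then have "400 * \<kappa> \<le> \<kappa> * \<kappa> * \<kappa>" using \<kappa> by (intro mult_right_mono) auto
      then show ?thesis by (simp add: power3_eq_cube)
    qed
    then have "5 * \<kappa> * real n \<le> \<kappa> ^ 3 / 80 * real n" by (intro mult_right_mono) auto
    ultimately show ?thesis by linarith
  qed
  also have "\<dots> = (2 / 5 + 1 / 80) * (\<kappa> ^ 3 * real n)" by (simp add: power3_eq_cube power2_eq_square algebra_simps)
  also have "\<dots> \<le> 1 * (\<kappa> ^ 3 * real n)" using \<kappa> by (intro mult_right_mono) auto
  finally show ?thesis using h_mem h_err h_le by (simp add: tracks_def refine E_def)
qed

lemma pivot_chain_tracks:
  assumes "concentrated \<kappa> n (\<lambda>k. p (X k))" "20 \<le> \<kappa>"
    and p: "p permutes {1..n}" and "\<And>k. k < n \<Longrightarrow> X k \<in> {1..n}"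
    and "round_one_correct lt X n p J" "4 ^ J \<le> n" "20 * real J \<le> \<kappa>"
    and t: "0 \<le> t" "t \<le> real n" and "j \<le> J"
  shows "tracks \<kappa> n p X t j (pivot_chain lt X n t j)"
  using \<open>j \<le> J\<close>
proof (induction j)
  case 0
  have "p 0 = 0" using p by (simp add: permutes_not_in)
  moreover have "t \<le> \<kappa> ^ 3 * real n"
    using t \<open>20 \<le> \<kappa>\<close> mult_right_mono[of 1 "\<kappa> ^ 3" "real n"] one_le_power[of \<kappa> 3] by simp
  ultimately show ?case using t by (simp add: tracks_def)
next
  case (Suc j)
  then show ?case using assms by (auto intro!: refine_tracks[where J = J])
qed

text \<open>At the last level \<open>2 ^ J\<close> is at least \<open>sqrt (real n) / 2\<close>, so
  the gap is at most \<open>2 * \<kappa> ^ 3 * sqrt (real n)\<close>. The accumulated estimation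
  error adds at most a fifth of \<open>\<kappa> ^ 3 * sqrt (real n)\<close>.\<close>

lemma pivot_chain_rank:
  assumes "concentrated \<kappa> n (\<lambda>k. p (X k))" and \<kappa>: "20 \<le> \<kappa>"
    and "p permutes {1..n}" and "\<And>k. k < n \<Longrightarrow> X k \<in> {1..n}"
    and "round_one_correct lt X n p J" and J: "4 ^ J \<le> n" "n < 4 ^ Suc J" "20 * real J \<le> \<kappa>"
    and t: "0 \<le> t" "t \<le> real n"
  shows "\<bar>real (p (fst (pivot_chain lt X n t J))) - t\<bar> < 3 * \<kappa> ^ 3 * sqrt (real n)"
proof -
  obtain a e where ae: "pivot_chain lt X n t J = (a, e)" by fastforce
  have "tracks \<kappa> n p X t J (a, e)"
    using pivot_chain_tracks[of \<kappa> n p X lt J t J] assms by (simp add: ae)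
  then have err: "\<bar>e - real (p a)\<bar> \<le> real J * (4 * \<kappa>\<^sup>2 * sqrt (real n))"
    and le: "e \<le> t" and gap: "(t - e) * 2 ^ J \<le> \<kappa> ^ 3 * real n"
    by (auto simp: tracks_def)
  define r where "r = sqrt (real n)"
  have n: "0 < n" using J(1) by (cases n) auto
  then have r: "0 < r" "r * r = real n" by (auto simp: r_def)
  have "real J * (4 * \<kappa>\<^sup>2 * r) \<le> (\<kappa> / 20) * (4 * \<kappa>\<^sup>2 * r)"
    using J r by (intro mult_right_mono) auto
  also have "\<dots> = \<kappa> ^ 3 * r / 5" by (simp add: power3_eq_cube power2_eq_square)
  finally have err': "\<bar>e - real (p a)\<bar> \<le> \<kappa> ^ 3 * r / 5" using err by (simp add: r_def)
  have "real n < real (4 ^ Suc J)" using J(2) by (simp only: of_nat_less_iff)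
  also have "\<dots> = (2 * 2 ^ J)\<^sup>2"
    by (simp add: power_mult_distrib power_mult[symmetric] mult.commute[of J] power_mult)
  finally have "r \<le> 2 * 2 ^ J" unfolding r_def by (intro real_le_lsqrt) auto
  then have "(t - e) * r \<le> (t - e) * (2 * 2 ^ J)" using le by (intro mult_left_mono) auto
  also have "\<dots> = 2 * ((t - e) * 2 ^ J)" by simp
  also have "\<dots> \<le> 2 * (\<kappa> ^ 3 * real n)" using gap by linarith
  also have "\<dots> = (2 * \<kappa> ^ 3 * r) * r" using r by simp
  finally have "t - e \<le> 2 * (\<kappa> ^ 3 * r)" using r by simp
  moreover have "0 < \<kappa> ^ 3 * r" using \<kappa> r by simp
  ultimately have "\<bar>real (p a) - t\<bar> < 3 * (\<kappa> ^ 3 * r)" using err' le by linarith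
  then show ?thesis by (simp add: ae r_def mult.assoc)
qed

subsection \<open>The algorithm\<close>


text \<open>This value of \<open>\<kappa>\<close> turns \<open>exp (- \<kappa> / 4)\<close> into
  \<open>n\<close> to the power -5, which beats the cubic union bound, and it is at least
  \<open>20 * levels n\<close>.\<close>

definition log_factor :: "nat \<Rightarrow> real" where
  "log_factor n = 20 * ln (real n)"

definition levels :: "nat \<Rightarrow> nat" where
  "levels n = nat \<lfloor>log 4 (real n)\<rfloor>"

text \<open>The bound of \<open>pivot_chain_rank\<close> for
  \<open>\<kappa> = log_factor n\<close>.\<close>

definition slack :: "nat \<Rightarrow> real" where
  "slack n = 3 * log_factor n ^ 3 * sqrt (real n)"

text \<open>The sentinel is never queried, so its place in the order is built in.\<close>

definition less_in :: "(nat \<times> nat) set \<Rightarrow> nat \<Rightarrow> nat \<Rightarrow> bool" where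
  "less_in H x y \<longleftrightarrow> x = 0 \<and> y \<noteq> 0 \<or> (x, y) \<in> H"

definition pivot :: "nat \<Rightarrow> (nat \<Rightarrow> nat) \<Rightarrow> (nat \<times> nat) set \<Rightarrow> real \<Rightarrow> nat" where
  "pivot n X H t = fst (pivot_chain (less_in H) X n t (levels n))"

definition round1 :: "nat \<Rightarrow> (nat \<Rightarrow> nat) \<Rightarrow> nat set set" where
  "round1 n X = comparisons n \<inter>
     (\<Union>j<levels n. (\<lambda>(i, k). {X i, X k}) ` ({..<2 ^ Suc j} \<times> {..<n div 2 ^ j}))"

definition round2 :: "nat \<Rightarrow> nat \<Rightarrow> nat \<Rightarrow> nat set set" where
  "round2 n a b = comparisons n \<inter> ((\<lambda>x. {a, x}) ` {1..n} \<union> (\<lambda>x. {b, x}) ` {1..n})"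

definition middle :: "nat \<Rightarrow> (nat \<times> nat) set \<Rightarrow> nat \<Rightarrow> nat \<Rightarrow> nat set" where
  "middle n H a b = {x \<in> {1..n}. (a, x) \<in> H \<and> (x, b) \<in> H}"

text \<open>The cutoff keeps the query bound valid in the worst case, even when the pivots are bad.
  Good pivots differ in rank by less than \<open>4 * slack n\<close>.\<close>

definition round3 :: "nat \<Rightarrow> nat set \<Rightarrow> nat set set" where
  "round3 n S = (if real (card S) \<le> 4 * slack n
     then comparisons n \<inter> (\<lambda>(x, y). {x, y}) ` (S \<times> S) else {})"

text \<open>
  Paths of length two suffice: an element outside the middle is separated from the others by a pivot.
\<close>

definition accepted :: "nat \<Rightarrow> (nat \<times> nat) set \<Rightarrow> nat set" where
  "accepted n H = {x \<in> {1..n}. n < 2 * (card {y \<in> {1..n}. (y, x) \<in> H \<union> H O H} + 1)}"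

text \<open>Both pivots are recomputed from the first answers \<open>H\<close> alone. Their targets
  are offset by \<open>slack n\<close>, so an error below \<open>slack n\<close> leaves each on its
  side of the median.\<close>

definition median_strategy :: "nat \<Rightarrow> (nat \<Rightarrow> nat) \<Rightarrow> strategy" where
  "median_strategy n X =
     (let low = (\<lambda>H. pivot n X H (real n / 2 - slack n));
          high = (\<lambda>H. pivot n X H (real n / 2 + slack n))
      in \<lparr>rounds = 3,
          ask = (\<lambda>hist. case hist of [] \<Rightarrow> round1 n X
            | H # hist' \<Rightarrow> (case hist' of [] \<Rightarrow> round2 n (low H) (high H)
              | H' # _ \<Rightarrow> round3 n (middle n H' (low H) (high H)))),
          decide = (\<lambda>hist. (accepted n (\<Union>(set hist)), {1..n} - accepted n (\<Union>(set hist))))\<rparr>)"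

lemma rounds_median_strategy [simp]: "rounds (median_strategy n X) = 3"
  by (simp add: median_strategy_def)

lemma valid_median_strategy: "valid_strategy n (median_strategy n X)"
  by (auto simp: valid_strategy_def median_strategy_def round1_def round2_def round3_def accepted_def
      split: list.splits)

section \<open>Worst-case query counts\<close>

lemma card_round1: "card (round1 n X) \<le> 2 * n * levels n"
proof -
  have "card (round1 n X) \<le>
      card (\<Union>j<levels n. (\<lambda>(i, k). {X i, X k}) ` ({..<2 ^ Suc j} \<times> {..<n div 2 ^ j}))"
    unfolding round1_def by (intro card_mono) auto
  also have "\<dots> \<le> (\<Sum>j<levels n. card ((\<lambda>(i, k). {X i, X k}) ` ({..<2 ^ Suc j} \<times> {..<n div 2 ^ j})))"
    by (intro card_UN_le) auto
  also have "\<dots> \<le> (\<Sum>j<levels n. 2 * n)"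
  proof (rule sum_mono)
    fix j
    have "card ((\<lambda>(i, k). {X i, X k}) ` ({..<2 ^ Suc j} \<times> {..<n div 2 ^ j}))
        \<le> card ({..<(2::nat) ^ Suc j} \<times> {..<n div 2 ^ j})"
      by (intro card_image_le) auto
    also have "\<dots> = 2 * (2 ^ j * (n div 2 ^ j))" by (simp add: card_cartesian_product)
    also have "\<dots> \<le> 2 * n" by (intro mult_left_mono) (auto simp: mult.commute div_times_less_eq_dividend)
    finally show "card ((\<lambda>(i, k). {X i, X k}) ` ({..<2 ^ Suc j} \<times> {..<n div 2 ^ j})) \<le> 2 * n" .
  qed
  finally show ?thesis by (simp add: mult.commute)
qed

lemma card_round2: "card (round2 n a b) \<le> 2 * n"
proof -
  have "card (round2 n a b) \<le> card ((\<lambda>x. {a, x}) ` {1..n} \<union> (\<lambda>x. {b, x}) ` {1..n})"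
    unfolding round2_def by (intro card_mono) auto
  also have "\<dots> \<le> card ((\<lambda>x. {a, x}) ` {1..n}) + card ((\<lambda>x. {b, x}) ` {1..n})"
    by (rule card_Un_le)
  also have "\<dots> \<le> card {1..n} + card {1..n}"
    by (intro add_mono card_image_le) auto
  finally show ?thesis by simp
qed

lemma card_round3:
  assumes "finite S"
  shows "real (card (round3 n S)) \<le> (4 * slack n)\<^sup>2"
proof (cases "real (card S) \<le> 4 * slack n")
  case True
  have "card (round3 n S) \<le> card ((\<lambda>(x, y). {x, y}) ` (S \<times> S))"
    unfolding round3_def using assms by (auto intro!: card_mono)
  also have "\<dots> \<le> card (S \<times> S)" using assms by (intro card_image_le) auto
  finally have "real (card (round3 n S)) \<le> (real (card S))\<^sup>2"
    by (simp add: card_cartesian_product power2_eq_square flip: of_nat_mult)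
  also have "\<dots> \<le> (4 * slack n)\<^sup>2" using True by (intro power_mono) auto
  finally show ?thesis .
qed (simp add: round3_def)

definition query_limit :: "nat \<Rightarrow> real" where
  "query_limit n = 2 * real n * real (levels n) + 2 * real n + (4 * slack n)\<^sup>2"

lemma num_queries_median_strategy:
  "real (num_queries (median_strategy n X) p) \<le> query_limit n"
proof -
  have "finite (middle n H a b)" for H a b by (simp add: middle_def)
  then have "real (card (round3 n (middle n H a b))) \<le> (4 * slack n)\<^sup>2" for H a b
    by (rule card_round3)
  moreover have "real (card (round1 n X)) \<le> 2 * real n * real (levels n)"
    using of_nat_mono[OF card_round1[of n X], where 'a = real] by simp
  moreover have "real (card (round2 n a b)) \<le> 2 * real n" for a b
    using card_round2[of n a b] by simp
  ultimately show ?thesis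
    unfolding query_limit_def num_queries_def rounds_median_strategy
    by (simp add: median_strategy_def numeral_3_eq_3 add_mono del: power_mult_numeral)
qed

section \<open>From bracketing pivots to the median partition\<close>

text \<open>True answers and their compositions only produce elements smaller than \<open>x\<close>,
  so at most \<open>p x - 1\<close> of them are counted.\<close>

lemma accepted_sound:
  assumes p: "p permutes {1..n}" and H: "H \<subseteq> {(x, y). p x < p y}" and x: "x \<in> accepted n H"
  shows "n < 2 * p x"
proof -
  have xn: "x \<in> {1..n}" "n < 2 * (card {y \<in> {1..n}. (y, x) \<in> H \<union> H O H} + 1)"
    using x by (auto simp: accepted_def)
  have "card {y \<in> {1..n}. (y, x) \<in> H \<union> H O H} \<le> card {1..<p x}"
  proof (rule card_inj_on_le)
    show "inj_on p {y \<in> {1..n}. (y, x) \<in> H \<union> H O H}" using p by (rule permutes_inj_on)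
    have "1 \<le> p y" if "y \<in> {1..n}" for y using permutes_in_image[OF p, of y] that by simp
    moreover have lt: "p u < p v" if "(u, v) \<in> H" for u v using H that by auto
    have "p y < p x" if "(y, x) \<in> H \<union> H O H" for y
      using that by (blast intro: lt less_trans)
    ultimately show "p ` {y \<in> {1..n}. (y, x) \<in> H \<union> H O H} \<subseteq> {1..<p x}"
      by (simp add: image_subset_iff)
  qed simp
  moreover have "1 \<le> p x" using permutes_in_image[OF p, of x] xn by simp
  ultimately show ?thesis using xn by simp
qed

text \<open>For \<open>x\<close> below \<open>b\<close>, a smaller \<open>y\<close> is seen directly
  in the middle, or through \<open>a\<close>. For \<open>x\<close> from \<open>b\<close> on, every
  \<open>y\<close> below \<open>b\<close> is seen through \<open>b\<close>.\<close>

lemma accepted_complete: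
  assumes p: "p permutes {1..n}" and ab: "a \<in> {1..n}" "b \<in> {1..n}" "2 * p a < n" "n < 2 * p b"
    and pivots: "\<And>x y. x \<in> {1..n} \<Longrightarrow> y \<in> {1..n} \<Longrightarrow> {x, y} \<inter> {a, b} \<noteq> {} \<Longrightarrow> p x < p y \<Longrightarrow> (x, y) \<in> H"
    and mid: "\<And>x y. x \<in> {1..n} \<Longrightarrow> y \<in> {1..n} \<Longrightarrow> p a < p x \<Longrightarrow> p x < p y \<Longrightarrow> p y < p b \<Longrightarrow> (x, y) \<in> H"
    and x: "x \<in> {1..n}" "n < 2 * p x"
  shows "x \<in> accepted n H"
proof -
  \<comment> \<open>Beyond \<open>b\<close> only the elements below \<open>b\<close> are sure to be
    counted; they suffice since \<open>b\<close> itself is above the median.\<close>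
  define r where "r = min (p x) (p b)"
  have inj: "u = v" if "p u = p v" for u v
    using permutes_inj[OF p] that by (simp add: inj_eq)
  have pn: "1 \<le> p y \<and> p y \<le> n" if "y \<in> {1..n}" for y using permutes_in_image[OF p, of y] that by simp
  have r: "1 \<le> r" "r \<le> n" using pn[OF x(1)] pn[OF ab(2)] by (auto simp: r_def)
  have sub: "{y \<in> {1..n}. p y < r} \<subseteq> {y \<in> {1..n}. (y, x) \<in> H \<union> H O H}"
  proof
    fix y assume "y \<in> {y \<in> {1..n}. p y < r}"
    then have y: "y \<in> {1..n}" "p y < p x" "p y < p b" by (auto simp: r_def)
    have "(y, x) \<in> H \<union> H O H"
    proof (cases "p x < p b")
      case True
      have "p a < p x" using ab x by linarith
      then have "(a, x) \<in> H" using pivots[of a x] ab x by simp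
      consider "p y < p a" | "y = a" | "p a < p y" using inj[of y a] by linarith
      then show ?thesis
      proof cases
        case 1
        then have "(y, a) \<in> H" using pivots[of y a] ab y by simp
        then show ?thesis using \<open>(a, x) \<in> H\<close> by blast
      next
        case 2
        then show ?thesis using \<open>(a, x) \<in> H\<close> by simp
      next
        case 3
        then show ?thesis using mid[of y x] y x True by simp
      qed
    next
      case False
      have yb: "(y, b) \<in> H" using pivots[of y b] ab y by simp
      show ?thesis
      proof (cases "x = b")
        case False
        then have "p b < p x" using \<open>\<not> p x < p b\<close> inj[of x b] by linarith
        then have "(b, x) \<in> H" using pivots[of b x] ab x by simp
        then show ?thesis using yb by blast
      qed (use yb in simp)
    qed
    then show "y \<in> {y \<in> {1..n}. (y, x) \<in> H \<union> H O H}" using y by simp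
  qed
  have "p ` {y \<in> {1..n}. p y < r} = {1..<r}"
  proof (intro equalityI subsetI)
    fix z assume z: "z \<in> {1..<r}"
    then have "z \<in> p ` {1..n}" using r by (auto simp only: permutes_image[OF p] atLeastAtMost_iff atLeastLessThan_iff)
    then show "z \<in> p ` {y \<in> {1..n}. p y < r}" using z by auto
  qed (use pn in auto)
  then have "card {y \<in> {1..n}. p y < r} = r - 1"
    using card_image[OF permutes_inj_on[OF p], of "{y \<in> {1..n}. p y < r}"] by simp
  then have "r - 1 \<le> card {y \<in> {1..n}. (y, x) \<in> H \<union> H O H}"
    using card_mono[OF _ sub] by simp
  moreover have "n < 2 * r" using x ab by (simp add: r_def min_def)
  ultimately show ?thesis using x by (simp add: accepted_def)
qed

text \<open>All indicators in both sums vanish. For even \<open>n\<close> the element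
  \<open>n / 2\<close> is rejected, but it occurs in neither sum.\<close>

lemma weighted_error_correct_partition:
  assumes p: "p permutes {1..n}" and A: "A = {x \<in> {1..n}. n < 2 * p x}"
  shows "weighted_error c n (p ` A, p ` ({1..n} - A)) = 0"
proof -
  have half: "n < 2 * i \<longleftrightarrow> real n / 2 < real i" for i by auto
  have "i \<notin> p ` ({1..n} - A)" if "real i > real n / 2" for i
    using that half[of i] by (auto simp: A)
  moreover have "i \<notin> p ` A" if "real i < real n / 2" for i
    using that half[of i] by (auto simp: A)
  ultimately show ?thesis
    unfolding weighted_error_def prod.case by (subst (1 2) sum.neutral) auto
qed

section \<open>Correctness on a concentrated sample\<close>

lemma levels_bounds:
  assumes "0 < n"
  shows "4 ^ levels n \<le> n" "n < 4 ^ Suc (levels n)" "real (levels n) \<le> ln (real n)"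
proof -
  have l0: "0 \<le> log 4 (real n)" using assms by simp
  then have "real (levels n) = real_of_int \<lfloor>log 4 (real n)\<rfloor>" by (simp add: levels_def)
  then have l: "real (levels n) \<le> log 4 (real n)" "log 4 (real n) < real (Suc (levels n))"
    using real_of_int_floor_add_one_gt[of "log 4 (real n)"] of_int_floor_le[of "log 4 (real n)"]
    by linarith+
  have "(4::real) ^ levels n = 4 powr real (levels n)" by (simp add: powr_realpow)
  also have "\<dots> \<le> 4 powr log 4 (real n)" using l by simp
  also have "\<dots> = real n" using assms by simp
  finally have "real (4 ^ levels n) \<le> real n" by simp
  then show "4 ^ levels n \<le> n" by (simp only: of_nat_le_iff)
  have "real n = 4 powr log 4 (real n)" using assms by simp
  also have "\<dots> < 4 powr real (Suc (levels n))" using l by (intro powr_less_mono) auto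
  also have "\<dots> = real (4 ^ Suc (levels n))" by (simp only: powr_realpow) simp
  finally show "n < 4 ^ Suc (levels n)" by (simp only: of_nat_less_iff)
  have "1 \<le> ln (4::real)" using exp_le by (simp add: ln_ge_iff)
  then have "ln (real n) / ln 4 \<le> ln (real n) / 1"
    using assms by (intro divide_left_mono) auto
  then show "real (levels n) \<le> ln (real n)" using l by (simp add: log_def)
qed

text \<open>Distinct sampled positions are compared outright. For equal positions both sides are
  false, and \<open>less_in\<close> settles the sentinel.\<close>

lemma round_one_correct_round1:
  assumes p: "p permutes {1..n}" and X: "\<And>k. k < n \<Longrightarrow> X k \<in> {1..n}" and "0 < n"
  shows "round_one_correct (less_in (answers p (round1 n X))) X n p (levels n)"
  unfolding round_one_correct_def
proof (intro allI impI ballI)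
  fix j x y
  assume j: "j < levels n" and x: "x \<in> insert 0 (X ` {..<2 ^ Suc j})"
    and y: "y \<in> insert 0 (X ` {..<n div 2 ^ j})"
  have p0: "p 0 = 0" using p by (simp add: permutes_not_in)
  have pos: "0 < p z \<longleftrightarrow> z \<noteq> 0" for z
    using inj_eq[OF permutes_inj[OF p], of z 0] p0 by auto
  have "(2::nat) ^ Suc j \<le> 4 ^ Suc j" by (intro power_mono) auto
  also have "\<dots> \<le> 4 ^ levels n" using j by (intro power_increasing) auto
  also have "\<dots> \<le> n" using levels_bounds[OF \<open>0 < n\<close>] by simp
  finally have jn: "2 ^ Suc j \<le> n" .
  have mn: "n div 2 ^ j \<le> n" by simp
  show "less_in (answers p (round1 n X)) x y \<longleftrightarrow> p x < p y"
  proof (cases "x = 0 \<or> y = 0")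
    case True
    then show ?thesis
      by (cases "y = 0") (simp_all add: less_in_def answers_def p0 pos[of y])
  next
    case False
    then obtain i k where ik: "x = X i" "i < 2 ^ Suc j" "y = X k" "k < n div 2 ^ j"
      using x y by auto
    have "i < n" "k < n" using ik jn mn by linarith+
    then have range: "x \<in> {1..n}" "y \<in> {1..n}" using X ik by simp_all
    have "{x, y} \<in> round1 n X" if "x \<noteq> y"
      unfolding round1_def
    proof (intro IntI UN_I)
      show "{x, y} \<in> comparisons n" using that range unfolding comparisons_def by blast
      show "j \<in> {..<levels n}" using j by simp
      show "{x, y} \<in> (\<lambda>(i, k). {X i, X k}) ` ({..<2 ^ Suc j} \<times> {..<n div 2 ^ j})"
        by (rule image_eqI[of _ _ "(i, k)"]) (use ik in auto)
    qed
    then show ?thesis using False by (auto simp: less_in_def answers_def)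
  qed
qed

text \<open>The deterministic core: once the sample is concentrated, the pivots bracket the median,
  the middle passes the cutoff of \<open>round3\<close>, and the accepted set is exact.\<close>

lemma output_median_strategy:
  fixes n :: nat
  assumes n: "0 < n" and p: "p permutes {1..n}" and X: "\<And>k. k < n \<Longrightarrow> X k \<in> {1..n}"
    and conc: "concentrated (log_factor n) n (\<lambda>k. p (X k))"
    and large: "20 \<le> log_factor n" "4 * slack n \<le> real n"
  shows "weighted_error c n (output_partition (median_strategy n X) p) = 0"
proof -
  define H1 where "H1 = answers p (round1 n X)"
  define a where "a = pivot n X H1 (real n / 2 - slack n)"
  define b where "b = pivot n X H1 (real n / 2 + slack n)"
  define H2 where "H2 = answers p (round2 n a b)"
  define S where "S = middle n H2 a b"
  define H3 where "H3 = answers p (round3 n S)"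
  define H where "H = H1 \<union> H2 \<union> H3"
  have out: "output_partition (median_strategy n X) p =
      (p ` accepted n H, p ` ({1..n} - accepted n H))"
    by (simp add: output_partition_def median_strategy_def numeral_3_eq_3 H_def H3_def S_def
        H2_def a_def b_def H1_def Un_assoc)
  have slack0: "0 \<le> slack n" using large by (simp add: slack_def)
  note bounds = levels_bounds[OF n]
  have close: "\<bar>real (p (pivot n X H1 t)) - t\<bar> < slack n" if "0 \<le> t" "t \<le> real n" for t
    unfolding pivot_def slack_def H1_def
    using conc large(1) p X round_one_correct_round1[OF p X n] bounds that
    by (intro pivot_chain_rank) (auto simp: log_factor_def)
  have a: "\<bar>real (p a) - (real n / 2 - slack n)\<bar> < slack n"
    unfolding a_def using large slack0 by (intro close) auto
  have b: "\<bar>real (p b) - (real n / 2 + slack n)\<bar> < slack n"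
    unfolding b_def using large slack0 by (intro close) auto
  \<comment> \<open>Since \<open>4 * slack n \<le> real n\<close>, the pivot \<open>a\<close> has
    positive rank and hence is not the sentinel.\<close>
  have pa: "2 * p a < n" "0 < p a" using a large by linarith+
  have pb: "n < 2 * p b" "p b \<le> n" using b large by linarith+
  have mem: "a \<in> {1..n}" "b \<in> {1..n}"
    using permutes_in_image[OF p, of a] permutes_in_image[OF p, of b] pa pb by auto
  have pivots: "(x, y) \<in> H2"
    if "x \<in> {1..n}" "y \<in> {1..n}" "{x, y} \<inter> {a, b} \<noteq> {}" "p x < p y" for x y
  proof -
    have "{x, y} \<in> comparisons n" using that by (auto simp: comparisons_def)
    moreover have "{x, y} \<in> (\<lambda>x. {a, x}) ` {1..n} \<union> (\<lambda>x. {b, x}) ` {1..n}"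
      using that by (auto simp: insert_commute)
    ultimately show ?thesis using that by (simp add: H2_def answers_def round2_def)
  qed
  have S: "S = {x \<in> {1..n}. p a < p x \<and> p x < p b}"
    using pivots mem by (auto simp: S_def middle_def H2_def answers_def)
  have "card S \<le> card {p a<..<p b}"
    using p by (intro card_inj_on_le[of p]) (auto simp: S permutes_inj_on)
  then have "real (card S) \<le> 4 * slack n" using a b by simp
  then have round3: "round3 n S = comparisons n \<inter> (\<lambda>(x, y). {x, y}) ` (S \<times> S)"
    by (simp add: round3_def)
  have mid: "(x, y) \<in> H3"
    if "x \<in> {1..n}" "y \<in> {1..n}" "p a < p x" "p x < p y" "p y < p b" for x y
  proof -
    have "x \<in> S" "y \<in> S" using that by (auto simp: S)
    then have "{x, y} \<in> round3 n S" using that by (auto simp: round3 comparisons_def)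
    then show ?thesis using that by (simp add: H3_def answers_def)
  qed
  have H: "H \<subseteq> {(x, y). p x < p y}" by (auto simp: H_def H1_def H2_def H3_def answers_def)
  have "x \<in> accepted n H" if "x \<in> {1..n}" "n < 2 * p x" for x
    using p mem pa(1) pb(1) _ _ that
  proof (rule accepted_complete)
    show "(x, y) \<in> H"
      if "x \<in> {1..n}" "y \<in> {1..n}" "{x, y} \<inter> {a, b} \<noteq> {}" "p x < p y" for x y
      using pivots[OF that] by (simp add: H_def)
    show "(x, y) \<in> H"
      if "x \<in> {1..n}" "y \<in> {1..n}" "p a < p x" "p x < p y" "p y < p b" for x y
      using mid[OF that] by (simp add: H_def)
  qed
  moreover have "accepted n H \<subseteq> {1..n}" by (auto simp: accepted_def)
  ultimately have "accepted n H = {x \<in> {1..n}. n < 2 * p x}"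
    using accepted_sound[OF p H] by blast
  then show ?thesis unfolding out by (rule weighted_error_correct_partition[OF p])
qed

section \<open>Failure probability and asymptotics\<close>

text \<open>Conditioning on the second component reduces the failure bound to a fixed input
  order.\<close>

lemma prob_pair_pmf_le:
  assumes "\<And>y. y \<in> set_pmf B \<Longrightarrow> measure_pmf.prob A {x. (x, y) \<in> E} \<le> \<delta>" and "0 \<le> \<delta>"
  shows "measure_pmf.prob (pair_pmf A B) E \<le> \<delta>"
proof -
  have "pair_pmf A B = bind_pmf B (\<lambda>y. map_pmf (\<lambda>x. (x, y)) A)"
    unfolding pair_pmf_def map_pmf_def by (rule bind_commute_pmf)
  then have "emeasure (pair_pmf A B) E = (\<integral>\<^sup>+y. emeasure A {x. (x, y) \<in> E} \<partial>B)"
    by (simp add: vimage_def)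
  also have "\<dots> \<le> (\<integral>\<^sup>+y. ennreal \<delta> \<partial>B)"
    using assms by (intro nn_integral_mono_AE)
      (auto simp: AE_measure_pmf_iff measure_pmf.emeasure_eq_measure ennreal_leI)
  also have "\<dots> = ennreal \<delta>" by (simp add: measure_pmf.emeasure_space_1)
  finally show ?thesis using \<open>0 \<le> \<delta>\<close> by (simp add: measure_pmf.emeasure_eq_measure)
qed

definition median_algorithm :: "nat \<Rightarrow> randomized_algorithm" where
  "median_algorithm n = map_pmf (median_strategy n) (random_sample n)"

lemma median_algorithm_error:
  assumes n: "0 < n" and large: "20 \<le> log_factor n" "4 * slack n \<le> real n"
  shows "measure_pmf.prob (outcome n (median_algorithm n)) {P. weighted_error c n P = 0}
           \<ge> 1 - 16 / real n ^ 2"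
proof -
  define fails where "fails = {P. weighted_error c n P \<noteq> 0}"
  define E where "E = {(a, p). output_partition a p \<in> fails}"
  have "measure_pmf.prob (outcome n (median_algorithm n)) fails
      = measure_pmf.prob (pair_pmf (median_algorithm n) (random_input n)) E"
    by (simp add: outcome_def E_def vimage_def case_prod_unfold)
  also have "\<dots> \<le> 16 / real n ^ 2"
  proof (rule prob_pair_pmf_le)
    fix p assume "p \<in> set_pmf (random_input n)"
    moreover have "{p. p permutes {1..n}} \<noteq> {}" using permutes_id by blast
    ultimately have p: "p permutes {1..n}"
      by (simp add: random_input_def finite_permutations)
    have "measure_pmf.prob (median_algorithm n) {a. (a, p) \<in> E}
        = measure_pmf.prob (random_sample n) {X. output_partition (median_strategy n X) p \<in> fails}"
      by (simp add: median_algorithm_def E_def vimage_def)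
    \<comment> \<open>The inclusion of events is shown on the support of
      \<open>random_sample n\<close>, where samples are genuine positions.\<close>
    also have "\<dots> \<le> measure_pmf.prob (random_sample n) {X. \<not> concentrated (log_factor n) n (\<lambda>k. p (X k))}"
      using output_median_strategy[OF n p _ _ large] random_sample_range
      by (intro measure_pmf.finite_measure_mono_AE) (auto simp: AE_measure_pmf_iff fails_def)
    also have "\<dots> \<le> 16 * real n ^ 3 * exp (- log_factor n / 4)"
      using prob_not_concentrated[OF p n, of "log_factor n"] large by simp
    also have "exp (- log_factor n / 4) = exp (ln (real n) * - 5)"
      by (simp add: log_factor_def)
    also have "\<dots> = 1 / real n ^ 5"
      using n by (simp add: exp_minus exp_of_nat2_mult[of _ 5, simplified] divide_inverse)
    also have "16 * real n ^ 3 * (1 / real n ^ 5) = 16 / real n ^ 2"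
      using n by (simp add: field_simps flip: power_add)
    finally show "measure_pmf.prob (median_algorithm n) {a. (a, p) \<in> E} \<le> 16 / real n ^ 2" .
  qed simp
  finally have "measure_pmf.prob (outcome n (median_algorithm n)) fails \<le> 16 / real n ^ 2" .
  moreover have "fails = - {P. weighted_error c n P = 0}" by (auto simp: fails_def)
  ultimately show ?thesis by (simp add: measure_pmf.prob_compl[simplified] Compl_eq_Diff_UNIV)
qed

text \<open>The third round dominates: the square of \<open>slack n\<close> is of order
  \<open>n * ln n ^ 6\<close>.\<close>

lemma query_limit_bigo: "query_limit \<in> O(\<lambda>n. real n * ln (real n) ^ 8)"
proof -
  have "query_limit \<in> O(\<lambda>n. 2 * real n * ln (real n) + 2 * real n
      + (4 * (3 * (20 * ln (real n)) ^ 3 * sqrt (real n)))\<^sup>2)"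
  proof (rule landau_o.big_mono)
    show "\<forall>\<^sub>F n in sequentially. norm (query_limit n) \<le> norm (2 * real n * ln (real n) + 2 * real n
      + (4 * (3 * (20 * ln (real n)) ^ 3 * sqrt (real n)))\<^sup>2)"
      using eventually_gt_at_top[of 0]
    proof eventually_elim
      case (elim n)
      have "0 \<le> query_limit n" by (simp add: query_limit_def)
      moreover have "2 * real n * real (levels n) \<le> 2 * real n * ln (real n)"
        using levels_bounds(3)[OF elim] by (intro mult_left_mono) auto
      ultimately show ?case by (simp add: query_limit_def slack_def log_factor_def)
    qed
  qed
  also have "(\<lambda>n. 2 * real n * ln (real n) + 2 * real n
      + (4 * (3 * (20 * ln (real n)) ^ 3 * sqrt (real n)))\<^sup>2) \<in> O(\<lambda>n. real n * ln (real n) ^ 8)"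
    by real_asymp
  finally show ?thesis .
qed

theorem theorem7:
  shows "\<exists>(M :: nat \<Rightarrow> randomized_algorithm) (q :: nat \<Rightarrow> real) (\<delta> :: nat \<Rightarrow> real).
    (\<forall>n. valid_algorithm n (M n)) \<and>
    (\<forall>n. has_round_complexity (M n) 3) \<and>
    (\<forall>n. query_bound n (M n) (q n)) \<and>
    q \<in> O(\<lambda>n. real n * ln (real n) ^ 8) \<and>
    (\<forall>c\<ge>0. \<forall>n. measure_pmf.prob (outcome n (M n)) {P. weighted_error c n P = 0} \<ge> 1 - \<delta> n) \<and>
    \<delta> \<in> O(\<lambda>n. ln (real n) / real n ^ 2)"
proof -
  have "\<forall>\<^sub>F n in sequentially. 20 \<le> 20 * ln (real n) \<and>
      4 * (3 * (20 * ln (real n)) ^ 3 * sqrt (real n)) \<le> real n \<and> 0 < n"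
    by (intro eventually_conj eventually_gt_at_top; real_asymp)
  then obtain n0 where n0: "\<And>n. n \<ge> n0 \<Longrightarrow> 20 \<le> log_factor n \<and> 4 * slack n \<le> real n \<and> 0 < n"
    by (auto simp: eventually_sequentially log_factor_def slack_def)
  \<comment> \<open>For the finitely many small \<open>n\<close> the value 1 makes the probability
    bound trivial.\<close>
  define \<delta> where "\<delta> = (\<lambda>n. if n < n0 then 1 else 16 / real n ^ 2)"
  have "\<delta> \<in> \<Theta>(\<lambda>n. 16 / real n ^ 2)"
    by (intro bigthetaI_cong eventually_mono[OF eventually_ge_at_top[of n0]]) (auto simp: \<delta>_def)
  also have "(\<lambda>n. 16 / real n ^ 2) \<in> O(\<lambda>n. ln (real n) / real n ^ 2)" by real_asymp
  finally have "\<delta> \<in> O(\<lambda>n. ln (real n) / real n ^ 2)" .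
  moreover have "measure_pmf.prob (outcome n (median_algorithm n)) {P. weighted_error c n P = 0} \<ge> 1 - \<delta> n"
    for c n
    using median_algorithm_error[of n c] n0[of n] by (auto simp: \<delta>_def not_less)
  moreover have "valid_algorithm n (median_algorithm n)" for n
    by (auto simp: valid_algorithm_def median_algorithm_def valid_median_strategy)
  moreover have "has_round_complexity (median_algorithm n) 3" for n
    by (auto simp: has_round_complexity_def median_algorithm_def)
  moreover have "query_bound n (median_algorithm n) (query_limit n)" for n
    by (auto simp: query_bound_def median_algorithm_def num_queries_median_strategy)
  ultimately show ?thesis using query_limit_bigo by blast
qed

end
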